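(* Let $\mu$ be a cardinal with $\mu>\mathrm{cf}(\mu)=\kappa>\aleph_0$ and $\lambda=\mu^+$. (1) $\clubsuit^\ast_{-\mu}(\lambda\setminus S^\lambda_\kappa)$ holds, and $\clubsuit^\ast_{-\mu}(S^\lambda_\kappa)/{\cal I}[\lambda,\kappa)$ holds. (2) If moreover $\mu$ is a strong limit cardinal, then $\clubsuit^\ast(\lambda\setminus S^\lambda_\kappa)$ holds and $\clubsuit^\ast(S^\lambda_\kappa)/{\cal I}[\lambda,\kappa)$ holds.
   Context: $LIM$ is the class of limit ordinals; $S^\lambda_\kappa=\{\delta<\lambda:\mathrm{cf}(\delta)=\kappa\}$. ${\cal I}[\lambda,\kappa)$ is the family of all $A\subseteq\lambda$ for which there is $h:\lambda\to\kappa$ such that for every $\delta\in A\cap S^\lambda_\kappa$ there is a club $C$ of $\delta$ with $h\restriction C$ strictly increasing. For a stationary $S\subseteq\lambda$: $\clubsuit^\ast_{-\mu}(S)$ means there is a sequence $\langle{\cal P}_\alpha:\alpha\in S\cap LIM\rangle$ such that each ${\cal P}_\alpha$ is a family of at most $|\alpha|$ unbounded subsets of $\alpha$, each of order type $<\mu$, and for every $A\in[\lambda]^\lambda$ there is a club $C_A$ of $\lambda$ with $C_A\cap S\cap LIM\subseteq G[A]:=\{\alpha:\exists B\in{\cal P}_\alpha\,(\alpha=\sup(B\cap A))\}$. $\clubsuit^\ast(S)$ means there is a sequence $\langle{\cal P}_\alpha:\alpha\in S\cap LIM\rangle$ such that $|{\cal P}_\alpha|\le|\alpha|$, every $B\in{\cal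 P}_\alpha$ is an unbounded subset of $\alpha$, and for every $A\in[\lambda]^\lambda$ there is a club $C_A$ of $\lambda$ with $C_A\cap S\cap LIM\subseteq G[A]:=\{\alpha:\exists B\in{\cal P}_\alpha\,(B\subseteq A)\}$. For an ideal ${\cal I}$ on $\lambda$, the versions $\clubsuit^\ast_{-\mu}(S)/{\cal I}$ and $\clubsuit^\ast(S)/{\cal I}$ are the same except that for each $A\in[\lambda]^\lambda$ it is only required that there be a club $C_A$ of $\lambda$ with $(C_A\cap S\cap LIM)\setminus G[A]\in{\cal I}$. *)

theory Defs
  imports Main
begin

text \<open>Ordinals below \<lambda> are modelled as the elements of a type 'a well-ordered by a
cardinal order L on UNIV (so the order type of L is the cardinal \<lambda>).  An element a
stands for the ordinal whose elements are underS L a.\<close>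

definition olt :: "'a rel \<Rightarrow> 'a \<Rightarrow> 'a \<Rightarrow> bool" where
  "olt L x y \<equiv> (x, y) \<in> L \<and> x \<noteq> y"

definition is_limit :: "'a rel \<Rightarrow> 'a \<Rightarrow> bool" where
  "is_limit L a \<equiv> (\<exists>b. olt L b a) \<and> (\<forall>b. olt L b a \<longrightarrow> (\<exists>c. olt L b c \<and> olt L c a))"

definition unbounded_in :: "'a rel \<Rightarrow> 'a set \<Rightarrow> 'a \<Rightarrow> bool" where
  "unbounded_in L X a \<equiv> \<forall>b. olt L b a \<longrightarrow> (\<exists>x\<in>X. (b, x) \<in> L)"

definition cof_type :: "'a rel \<Rightarrow> 'a \<Rightarrow> 'a \<Rightarrow> bool" where
  "cof_type L a c \<equiv> \<exists>X. X \<subseteq> underS L a \<and> unbounded_in L X a \<and>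
      (Restr L X, Restr L (underS L c)) \<in> ordIso"

definition is_cof :: "'a rel \<Rightarrow> 'a \<Rightarrow> 'a \<Rightarrow> bool" where
  "is_cof L a c \<equiv> cof_type L a c \<and> (\<forall>c'. olt L c' c \<longrightarrow> \<not> cof_type L a c')"

definition S_cf :: "'a rel \<Rightarrow> 'a \<Rightarrow> 'a set" where
  "S_cf L k = {d. is_cof L d k}"

definition is_sup :: "'a rel \<Rightarrow> 'a set \<Rightarrow> 'a \<Rightarrow> bool" where
  "is_sup L X a \<equiv> (\<forall>x\<in>X. (x, a) \<in> L) \<and> (\<forall>b. (\<forall>x\<in>X. (x, b) \<in> L) \<longrightarrow> (a, b) \<in> L)"

definition club :: "'a rel \<Rightarrow> 'a set \<Rightarrow> bool" where
  "club L C \<equiv> (\<forall>b. \<exists>c\<in>C. (b, c) \<in> L) \<and>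
     (\<forall>a. is_limit L a \<and> unbounded_in L (C \<inter> underS L a) a \<longrightarrow> a \<in> C)"

definition club_of :: "'a rel \<Rightarrow> 'a set \<Rightarrow> 'a \<Rightarrow> bool" where
  "club_of L C d \<equiv> C \<subseteq> underS L d \<and> unbounded_in L C d \<and>
     (\<forall>a. olt L a d \<and> is_limit L a \<and> unbounded_in L (C \<inter> underS L a) a \<longrightarrow> a \<in> C)"

definition I_lk :: "'a rel \<Rightarrow> 'a \<Rightarrow> 'a set set" where
  "I_lk L k = {A. \<exists>h. (\<forall>x. olt L (h x) k) \<and>
      (\<forall>d \<in> A \<inter> S_cf L k. \<exists>C. club_of L C d \<and>
          (\<forall>x\<in>C. \<forall>y\<in>C. olt L x y \<longrightarrow> olt L (h x) (h y)))}"

definition G_minus :: "'a rel \<Rightarrow> ('a \<Rightarrow> 'a set set) \<Rightarrow> 'a set \<Rightarrow> 'a set" where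
  "G_minus L P A = {a. \<exists>B\<in>P a. is_sup L (B \<inter> A) a}"

definition G_plain :: "('a \<Rightarrow> 'a set set) \<Rightarrow> 'a set \<Rightarrow> 'a set" where
  "G_plain P A = {a. \<exists>B\<in>P a. B \<subseteq> A}"

definition fam_minus :: "'a rel \<Rightarrow> 'a \<Rightarrow> 'a \<Rightarrow> 'a set set \<Rightarrow> bool" where
  "fam_minus L m a Pa \<equiv> (card_of Pa, card_of (underS L a)) \<in> ordLeq \<and>
     (\<forall>B\<in>Pa. B \<subseteq> underS L a \<and> unbounded_in L B a \<and>
        (Restr L B, Restr L (underS L m)) \<in> ordLess)"

definition fam_plain :: "'a rel \<Rightarrow> 'a \<Rightarrow> 'a set set \<Rightarrow> bool" where
  "fam_plain L a Pa \<equiv> (card_of Pa, card_of (underS L a)) \<in> ordLeq \<and>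
     (\<forall>B\<in>Pa. B \<subseteq> underS L a \<and> unbounded_in L B a)"

definition clubsuit_minus :: "'a rel \<Rightarrow> 'a \<Rightarrow> 'a set \<Rightarrow> bool" where
  "clubsuit_minus L m S \<equiv> \<exists>P. (\<forall>a\<in>S. is_limit L a \<longrightarrow> fam_minus L m a (P a)) \<and>
     (\<forall>A. (card_of A, card_of (UNIV :: 'a set)) \<in> ordIso \<longrightarrow>
        (\<exists>C. club L C \<and> {a \<in> C \<inter> S. is_limit L a} \<subseteq> G_minus L P A))"

definition clubsuit_minus_ideal :: "'a rel \<Rightarrow> 'a \<Rightarrow> 'a set \<Rightarrow> 'a set set \<Rightarrow> bool" where
  "clubsuit_minus_ideal L m S I \<equiv> \<exists>P. (\<forall>a\<in>S. is_limit L a \<longrightarrow> fam_minus L m a (P a)) \<and>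
     (\<forall>A. (card_of A, card_of (UNIV :: 'a set)) \<in> ordIso \<longrightarrow>
        (\<exists>C. club L C \<and> {a \<in> C \<inter> S. is_limit L a} - G_minus L P A \<in> I))"

definition clubsuit_star :: "'a rel \<Rightarrow> 'a set \<Rightarrow> bool" where
  "clubsuit_star L S \<equiv> \<exists>P. (\<forall>a\<in>S. is_limit L a \<longrightarrow> fam_plain L a (P a)) \<and>
     (\<forall>A. (card_of A, card_of (UNIV :: 'a set)) \<in> ordIso \<longrightarrow>
        (\<exists>C. club L C \<and> {a \<in> C \<inter> S. is_limit L a} \<subseteq> G_plain P A))"

definition clubsuit_star_ideal :: "'a rel \<Rightarrow> 'a set \<Rightarrow> 'a set set \<Rightarrow> bool" where
  "clubsuit_star_ideal L S I \<equiv> \<exists>P. (\<forall>a\<in>S. is_limit L a \<longrightarrow> fam_plain L a (P a)) \<and>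
     (\<forall>A. (card_of A, card_of (UNIV :: 'a set)) \<in> ordIso \<longrightarrow>
        (\<exists>C. club L C \<and> {a \<in> C \<inter> S. is_limit L a} - G_plain P A \<in> I))"

definition is_cardinal :: "'a rel \<Rightarrow> 'a \<Rightarrow> bool" where
  "is_cardinal L m \<equiv> \<forall>b. olt L b m \<longrightarrow> (card_of (underS L b), card_of (underS L m)) \<in> ordLess"

definition strong_limit :: "'a rel \<Rightarrow> 'a \<Rightarrow> bool" where
  "strong_limit L m \<equiv> \<forall>b. olt L b m \<longrightarrow>
     (card_of (Pow (underS L b)), card_of (underS L m)) \<in> ordLess"

end

theory Submission
  imports Defs
begin

text \<open>Write every \<open>b < \<lambda>\<close> as an increasing union of sets \<open>a b i\<close> (\<open>i < \<kappa>\<close>) of size \<open>< \<mu>\<close>, with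
a bound on the size that depends on \<open>i\<close> only. If \<open>A \<inter> d\<close> is unbounded in \<open>d\<close> and
\<open>cf d \<noteq> \<kappa>\<close>, then already some \<open>A \<inter> a d i\<close> is unbounded in \<open>d\<close>, so the sets \<open>a d i\<close> guess \<open>A\<close>
at \<open>d\<close>. If \<open>cf d = \<kappa>\<close>, let \<open>E\<close> be the set of limit points below \<open>d\<close> of a cofinal set of type
\<open>\<kappa>\<close>; its members have cofinality \<open>< \<kappa>\<close>, and the guesses at \<open>d\<close> are
\<open>B i = (\<Union>b\<in>E. a b i)\<close>. Given \<open>A\<close>, let \<open>h b\<close> be some \<open>i\<close> such that \<open>A \<inter> a b i\<close> is unbounded
in \<open>b\<close>. If every \<open>B i \<inter> A\<close> is bounded in \<open>d\<close>, by \<open>g i\<close> say, then \<open>h b > i\<close> for each \<open>b > g i\<close>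
among the limit points of \<open>A\<close> in \<open>E\<close>; hence \<open>h\<close> is strictly increasing on the club of those
\<open>b\<close> that are closed under \<open>g \<circ> h\<close>, and \<open>d\<close> is caught by the ideal. For strong limit \<open>\<mu>\<close> all subsets
of the guesses can be added to the families.\<close>

unbundle cardinal_syntax

lemma Pow_ordLeq_mono:
  assumes "|A| \<le>o |B|" shows "|Pow A| \<le>o |Pow B|"
proof -
  obtain f where "inj_on f A" "f ` A \<subseteq> B" using assms card_of_ordLeq by metis
  then show ?thesis by (intro card_of_ordLeqI[of "image f"] inj_on_image_Pow) auto
qed

section \<open>Order types and cofinality in a wellorder\<close>

text \<open>The definitions are applied to the order relation of an abstract wellorder; the theorem
is recovered by interpreting \<open>\<le>\<close> as membership in \<open>L\<close>.\<close>

context wellorder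
begin

abbreviation le_rel :: "'a rel" where "le_rel \<equiv> {(x, y). x \<le> y}"

lemma Well_order_le_rel: "Well_order le_rel" and Field_le_rel: "Field le_rel = UNIV"
proof -
  show F: "Field le_rel = UNIV" by (auto simp: Field_def)
  have "wf (le_rel - Id)"
  proof (rule wfUNIVI)
    fix P x assume "\<forall>x. (\<forall>y. (y, x) \<in> le_rel - Id \<longrightarrow> P y) \<longrightarrow> P x"
    then show "P x" by (induction x rule: less_induct) (auto simp: less_le)
  qed
  then show "Well_order le_rel"
    unfolding F by (auto simp: well_order_on_def linear_order_on_def partial_order_on_def
      preorder_on_def refl_on_def trans_def antisym_def total_on_def)
qed

lemma olt_le_rel [simp]: "olt le_rel x y \<longleftrightarrow> x < y"
  by (auto simp: olt_def less_le)

lemma underS_le_rel [simp]: "underS le_rel a = {..<a}"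
  by (auto simp: underS_def less_le)

lemma Field_Restr_le_rel [simp]: "Field (Restr le_rel X) = X"
  by (auto simp: Field_def)

lemma Restr_le_rel_Well_order: "Well_order (Restr le_rel X)"
  by (rule Well_order_Restr[OF Well_order_le_rel])

text \<open>A strictly increasing map on a linear order is injective and reflects the order. The
  witness runs from \<open>Y\<close> to \<open>X\<close>, because in \<open>cof_type\<close> the
  second set is the initial segment that serves as index set.\<close>

lemma Restr_ordIso_iff:
  "(Restr le_rel X, Restr le_rel Y) \<in> ordIso \<longleftrightarrow>
    (\<exists>e. (\<forall>x\<in>Y. \<forall>y\<in>Y. x < y \<longrightarrow> e x < e y) \<and> e ` Y = X)"
proof
  assume "(Restr le_rel X, Restr le_rel Y) \<in> ordIso"
  then obtain e where "iso (Restr le_rel Y) (Restr le_rel X) e"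
    using ordIso_symmetric unfolding ordIso_def by blast
  then have e: "bij_betw e Y X" "\<And>a b. a \<in> Y \<Longrightarrow> b \<in> Y \<Longrightarrow> a \<le> b \<longleftrightarrow> e a \<le> e b"
    unfolding iso_iff2 by (auto simp: bij_betw_def)
  then have "\<forall>x\<in>Y. \<forall>y\<in>Y. x < y \<longrightarrow> e x < e y"
    by (auto simp: not_le[symmetric])
  with e(1) show "\<exists>e. (\<forall>x\<in>Y. \<forall>y\<in>Y. x < y \<longrightarrow> e x < e y) \<and> e ` Y = X"
    by (auto simp: bij_betw_def)
next
  assume "\<exists>e. (\<forall>x\<in>Y. \<forall>y\<in>Y. x < y \<longrightarrow> e x < e y) \<and> e ` Y = X"
  then obtain e where e: "\<And>x y. x \<in> Y \<Longrightarrow> y \<in> Y \<Longrightarrow> x < y \<Longrightarrow> e x < e y" "e ` Y = X" by blast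
  have le: "a \<le> b \<longleftrightarrow> e a \<le> e b" if "a \<in> Y" "b \<in> Y" for a b
    using e(1)[OF that] e(1)[OF that(2,1)]
    by (cases a b rule: linorder_cases) (auto simp: not_le dest: less_imp_le)
  have "inj_on e Y"
    by (rule inj_onI) (metis le order_antisym order_refl)
  then have "iso (Restr le_rel Y) (Restr le_rel X) e"
    unfolding iso_iff2 using e(2) le by (auto simp: bij_betw_def)
  then have "(Restr le_rel Y, Restr le_rel X) \<in> ordIso"
    unfolding ordIso_def using Restr_le_rel_Well_order by blast
  then show "(Restr le_rel X, Restr le_rel Y) \<in> ordIso" by (rule ordIso_symmetric)
qed

lemma ordLess_Restr_le_rel:
  assumes "(r, Restr le_rel Y) \<in> ordLess"
  shows "\<exists>a \<in> Y. (r, Restr le_rel (Y \<inter> {..<a})) \<in> ordIso"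
proof -
  have "Well_order r" using assms by (auto simp: ordLess_def)
  then obtain a where "a \<in> Y" "(r, Restr (Restr le_rel Y) (underS (Restr le_rel Y) a)) \<in> ordIso"
    using assms ordLess_iff_ordIso_Restr[OF Restr_le_rel_Well_order] by auto
  moreover from this have "underS (Restr le_rel Y) a = Y \<inter> {..<a}"
    by (auto simp: underS_def less_le)
  moreover have "Restr (Restr le_rel Y) (Y \<inter> {..<a}) = Restr le_rel (Y \<inter> {..<a})" by auto
  ultimately show ?thesis by auto
qed

text \<open>Were \<open>{..<c}\<close> the shorter one, some strictly increasing \<open>g\<close>
  would map it into \<open>I \<inter> {..<i}\<close> with \<open>i < c\<close>. Induction gives
  \<open>x \<le> g x\<close> below \<open>c\<close>, while \<open>g i < i\<close>.\<close>

lemma Restr_subset_initial_segment: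
  assumes "I \<subseteq> {..<c}"
  obtains c' where "c' \<le> c" "(Restr le_rel I, Restr le_rel {..<c'}) \<in> ordIso"
proof -
  have "\<not> (Restr le_rel {..<c}, Restr le_rel I) \<in> ordLess"
  proof
    assume "(Restr le_rel {..<c}, Restr le_rel I) \<in> ordLess"
    from ordLess_Restr_le_rel[OF this] obtain i where i: "i \<in> I"
      "(Restr le_rel (I \<inter> {..<i}), Restr le_rel {..<c}) \<in> ordIso"
      using ordIso_symmetric by blast
    then obtain g where g: "\<And>x y. x < c \<Longrightarrow> y < c \<Longrightarrow> x < y \<Longrightarrow> g x < g y"
      "g ` {..<c} = I \<inter> {..<i}"
      unfolding Restr_ordIso_iff by auto
    have "i < c" using i assms by auto
    have "x < c \<Longrightarrow> x \<le> g x" for x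
    proof (induction x rule: less_induct)
      case (less x)
      show ?case
      proof (rule ccontr)
        assume "\<not> x \<le> g x"
        then have "g x < x" by simp
        moreover from this less.prems have "g x < c" by simp
        ultimately have "g (g x) < g x" using less.prems g(1) by blast
        then show False using less.IH[OF \<open>g x < x\<close> \<open>g x < c\<close>] by simp
      qed
    qed
    then have "i \<le> g i" using \<open>i < c\<close> by blast
    moreover have "g i < i" using g(2) \<open>i < c\<close> by blast
    ultimately show False by simp
  qed
  then have "(Restr le_rel I, Restr le_rel {..<c}) \<in> ordLeq"
    using ordLess_or_ordLeq[OF Restr_le_rel_Well_order Restr_le_rel_Well_order] by blast
  then consider "(Restr le_rel I, Restr le_rel {..<c}) \<in> ordIso"
    | "(Restr le_rel I, Restr le_rel {..<c}) \<in> ordLess"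
    using ordLeq_iff_ordLess_or_ordIso by blast
  then show ?thesis
  proof cases
    case 1
    then show ?thesis by (rule that[OF order_refl])
  next
    case 2
    from ordLess_Restr_le_rel[OF this] obtain a where a: "a < c"
      "(Restr le_rel I, Restr le_rel ({..<c} \<inter> {..<a})) \<in> ordIso" by auto
    moreover from a have "{..<c} \<inter> {..<a} = {..<a}" by auto
    ultimately show ?thesis using that[of a] by simp
  qed
qed

lemma unbounded_in_le_rel: "unbounded_in le_rel X a \<longleftrightarrow> (\<forall>b<a. \<exists>x\<in>X. b \<le> x)"
  by (simp add: unbounded_in_def)

lemma unbounded_in_mono: "unbounded_in le_rel X a \<Longrightarrow> X \<subseteq> Y \<Longrightarrow> unbounded_in le_rel Y a"
  unfolding unbounded_in_le_rel by blast

lemma is_limit_le_rel: "is_limit le_rel a \<longleftrightarrow> (\<exists>b. b < a) \<and> (\<forall>b<a. \<exists>c>b. c < a)"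
  by (simp add: is_limit_def)

lemma cof_type_le_rel:
  "cof_type le_rel a c \<longleftrightarrow>
    (\<exists>e. (\<forall>x<c. \<forall>y<c. x < y \<longrightarrow> e x < e y) \<and> e ` {..<c} \<subseteq> {..<a} \<and>
      unbounded_in le_rel (e ` {..<c}) a)"
  unfolding cof_type_def underS_le_rel Restr_ordIso_iff Ball_def lessThan_iff by (intro iffI; elim exE conjE; blast)

text \<open>Lets cofinalities be bounded through maps that need not be monotone.\<close>

lemma cof_type_of_unbounded_image:
  assumes f: "f ` {..<c} \<subseteq> {..<d}" "unbounded_in le_rel (f ` {..<c}) d"
  obtains c' where "c' \<le> c" "cof_type le_rel d c'"
proof -
  \<comment> \<open>the places where \<open>f\<close> attains a new strict maximum\<close>
  define I where "I = {i. i < c \<and> (\<forall>j<i. f j < f i)}"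
  have unb: "unbounded_in le_rel (f ` I) d"
    unfolding unbounded_in_le_rel
  proof (intro allI impI)
    fix b assume "b < d"
    then obtain j where j: "j < c \<and> b \<le> f j" using f(2) by (auto simp: unbounded_in_le_rel)
    \<comment> \<open>All values before the first one reaching \<open>b\<close> are below
      \<open>b\<close>, so this index attains a new maximum.\<close>
    define i where "i = (LEAST i. i < c \<and> b \<le> f i)"
    have i: "i < c \<and> b \<le> f i" unfolding i_def using j by (rule LeastI)
    have "f l < f i" if "l < i" for l
      using not_less_Least[OF that[unfolded i_def]] that i by (auto intro: less_le_trans less_trans)
    then show "\<exists>x\<in>f ` I. b \<le> x" using i by (auto simp: I_def)
  qed
  have "I \<subseteq> {..<c}" by (auto simp: I_def)
  then obtain c' where c': "c' \<le> c" "(Restr le_rel I, Restr le_rel {..<c'}) \<in> ordIso"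
    by (rule Restr_subset_initial_segment)
  have "(Restr le_rel (f ` I), Restr le_rel I) \<in> ordIso"
    unfolding Restr_ordIso_iff by (rule exI[of _ f]) (auto simp: I_def)
  then have "(Restr le_rel (f ` I), Restr le_rel {..<c'}) \<in> ordIso"
    using c'(2) by (rule ordIso_transitive)
  then have "cof_type le_rel d c'"
    unfolding cof_type_def using unb f(1) \<open>I \<subseteq> {..<c}\<close> by (intro exI[of _ "f ` I"]) auto
  with c'(1) show ?thesis by (rule that)
qed

section \<open>Limit points and closure points\<close>

text \<open>\<open>unbounded_in\<close> is non-strict, so without \<open>is_limit\<close> zero and
  the successors of members of \<open>X\<close> would count as well.\<close>

definition limit_points :: "'a set \<Rightarrow> 'a set" where
  "limit_points X = {a. is_limit le_rel a \<and> unbounded_in le_rel (X \<inter> {..<a}) a}"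

lemma limit_pointsD: "a \<in> limit_points X \<Longrightarrow> b < a \<Longrightarrow> \<exists>x\<in>X. b \<le> x \<and> x < a"
  by (auto simp: limit_points_def unbounded_in_le_rel)

lemma limit_pointsI:
  "is_limit le_rel a \<Longrightarrow> (\<And>b. b < a \<Longrightarrow> \<exists>x\<in>X. b \<le> x \<and> x < a) \<Longrightarrow> a \<in> limit_points X"
  by (auto simp: limit_points_def unbounded_in_le_rel)

lemma limit_points_closed:
  assumes "is_limit le_rel a" "unbounded_in le_rel (limit_points X \<inter> {..<a}) a"
  shows "a \<in> limit_points X"
proof -
  have "\<exists>x\<in>X \<inter> {..<a}. b \<le> x" if b: "b < a" for b
  proof -
    from assms(1) b obtain c where c: "b < c" "c < a" by (auto simp: is_limit_le_rel)
    then obtain z where "z \<in> limit_points X" "z < a" "c \<le> z"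
      using assms(2) by (auto simp: unbounded_in_le_rel)
    moreover from this have "b < z" using c by (blast intro: less_le_trans)
    ultimately obtain x where "x \<in> X" "x < z" "b \<le> x"
      by (auto simp: limit_points_def unbounded_in_le_rel)
    with \<open>z < a\<close> show ?thesis by (blast intro: less_trans lessThan_iff[THEN iffD2])
  qed
  then show ?thesis using assms(1) by (simp add: limit_points_def unbounded_in_le_rel)
qed

text \<open>The point is the least upper bound of \<omega> iterations of \<open>step\<close> from
  \<open>b\<close>: each \<open>b'\<close> below it lies below some \<open>F n\<close>, and
  \<open>mono\<close> passes \<open>R (F n) (F (Suc n))\<close> down to \<open>b'\<close>. It is
  applied to the whole type and to \<open>{..<d}\<close>.\<close>

lemma ex_closure_point:
  assumes bnd: "\<And>F :: nat \<Rightarrow> 'a. range F \<subseteq> D \<Longrightarrow> \<exists>u\<in>D. \<forall>n. F n \<le> u"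
    and down: "\<And>x y. y \<in> D \<Longrightarrow> x \<le> y \<Longrightarrow> x \<in> D"
    and step: "\<And>b. b \<in> D \<Longrightarrow> \<exists>c\<in>D. b < c \<and> R b c"
    and mono: "\<And>b' b c. b' \<le> b \<Longrightarrow> R b c \<Longrightarrow> R b' c"
    and b: "b \<in> D"
  obtains a where "a \<in> D" "b < a" "is_limit le_rel a" "\<And>b'. b' < a \<Longrightarrow> \<exists>c<a. b' < c \<and> R b' c"
proof -
  define F where "F = rec_nat b (\<lambda>_ x. SOME c. c \<in> D \<and> x < c \<and> R x c)"
  have F0: "F 0 = b" and FS: "F (Suc n) = (SOME c. c \<in> D \<and> F n < c \<and> R (F n) c)" for n
    by (simp_all add: F_def)
  have next_F: "c \<in> D \<Longrightarrow> (SOME c'. c' \<in> D \<and> c < c' \<and> R c c') \<in> D \<and>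
      c < (SOME c'. c' \<in> D \<and> c < c' \<and> R c c') \<and> R c (SOME c'. c' \<in> D \<and> c < c' \<and> R c c')" for c
    by (rule someI_ex) (use step in blast)
  have FD: "F n \<in> D" for n by (induction n) (use b next_F in \<open>auto simp: F0 FS\<close>)
  have F: "F n < F (Suc n)" "R (F n) (F (Suc n))" for n
    using next_F[OF FD[of n]] by (simp_all add: FS)
  obtain u where u: "u \<in> D" "\<forall>n. F n \<le> u" using bnd[of F] FD by blast
  define a where "a = (LEAST u. \<forall>n. F n \<le> u)"
  have a: "\<forall>n. F n \<le> a" unfolding a_def using u(2) by (rule LeastI)
  have aD: "a \<in> D" using down[OF u(1)] Least_le[of "\<lambda>u. \<forall>n. F n \<le> u", OF u(2)] by (simp add: a_def)
  have Fa: "F n < a" for n using F(1)[of n] a by (auto intro: less_le_trans)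
  have ex: "\<exists>n. b' < F n" if "b' < a" for b'
    using not_less_Least[OF that[unfolded a_def]] by (auto simp: not_le)
  have cl: "\<exists>c<a. b' < c \<and> R b' c" if "b' < a" for b'
  proof -
    from ex[OF that] obtain n where "b' < F n" by blast
    then show ?thesis using F[of n] mono[of b' "F n" "F (Suc n)"] Fa[of "Suc n"]
      by (auto intro: less_trans less_imp_le)
  qed
  show ?thesis
  proof (rule that[OF aD])
    show "b < a" using Fa[of 0] F0 by simp
    then show "is_limit le_rel a" using cl by (auto simp: is_limit_le_rel)
  qed (rule cl)
qed

lemma is_sup_iff_unbounded:
  assumes "is_limit le_rel a" "X \<subseteq> {..<a}"
  shows "is_sup le_rel X a \<longleftrightarrow> unbounded_in le_rel X a"
proof
  assume s: "is_sup le_rel X a"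
  show "unbounded_in le_rel X a" unfolding unbounded_in_le_rel
  proof (intro allI impI, rule ccontr)
    fix b assume "b < a" "\<not> (\<exists>x\<in>X. b \<le> x)"
    then have "\<forall>x\<in>X. x \<le> b" by (auto simp: not_le)
    then have "a \<le> b" using s by (auto simp: is_sup_def)
    with \<open>b < a\<close> show False by simp
  qed
next
  assume u: "unbounded_in le_rel X a"
  have "a \<le> b" if "\<forall>x\<in>X. x \<le> b" for b
  proof (rule ccontr)
    assume "\<not> a \<le> b"
    then obtain c where "b < c" "c < a" using assms(1) by (auto simp: is_limit_le_rel not_le)
    then obtain x where "x \<in> X" "c \<le> x" using u by (auto simp: unbounded_in_le_rel)
    with \<open>b < c\<close> that show False by force
  qed
  then show "is_sup le_rel X a" using assms(2) by (auto simp: is_sup_def less_imp_le)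
qed

lemma Restr_ordLess_of_card:
  assumes "|B| <o |M|" shows "(Restr le_rel B, Restr le_rel M) \<in> ordLess"
proof (rule ccontr)
  assume "\<not> ?thesis"
  then have "(Restr le_rel M, Restr le_rel B) \<in> ordLeq"
    using ordLess_or_ordLeq[OF Restr_le_rel_Well_order Restr_le_rel_Well_order] by blast
  from card_of_mono2[OF this] have "|M| \<le>o |B|" by simp
  with assms show False using not_ordLess_ordLeq by blast
qed


text \<open>If \<open>f\<close> were unbounded, reindexing \<open>J\<close> by \<open>{..<c}\<close>
  would produce a cofinal type at most \<open>c\<close>, against the minimality of
  \<open>k\<close>.\<close>

lemma is_cof_bounded:
  assumes d: "is_cof le_rel d k" and f: "f ` J \<subseteq> {..<d}" and J: "|J| \<le>o |{..<c}|" "c < k"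
  shows "\<exists>u<d. \<forall>j\<in>J. f j < u"
proof (rule ccontr)
  assume "\<not> ?thesis"
  then have unb: "\<forall>u<d. \<exists>j\<in>J. u \<le> f j" by (meson not_less)
  \<comment> \<open>A cofinal map from \<open>{..<k}\<close> takes a value at \<open>c\<close>, so
    \<open>d\<close> is not zero. Hence \<open>J\<close> is nonempty, which a surjection from
    \<open>{..<c}\<close> onto \<open>J\<close> requires.\<close>
  have "\<exists>u. u < d"
    using d J(2) unfolding is_cof_def cof_type_le_rel by blast
  with unb have "J \<noteq> {}" by auto
  then obtain g where g: "g ` {..<c} = J" using J(1) card_of_ordLeq2[of J "{..<c}"] by auto
  have "(f \<circ> g) ` {..<c} = f ` J" unfolding image_comp[symmetric] g ..
  moreover have "unbounded_in le_rel (f ` J) d" using unb by (auto simp: unbounded_in_le_rel)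
  ultimately obtain c' where "c' \<le> c" "cof_type le_rel d c'"
    using cof_type_of_unbounded_image[of "f \<circ> g" c d] f by metis
  moreover from this J(2) have "c' < k" by simp
  ultimately show False using d by (simp add: is_cof_def)
qed

section \<open>Guessing at the successor of a singular cardinal\<close>

text \<open>Here \<open>m\<close> is \<mu> and \<open>k\<close> is \<kappa>.
  \<open>card_below\<close> and \<open>card_UNIV\<close> together say that the order type of the
  whole type is the cardinal successor of \<mu>.\<close>

context
  fixes m k :: 'a
  assumes cardinal_m: "\<And>b. b < m \<Longrightarrow> |{..<b}| <o |{..<m}|"
    and card_below: "\<And>x. |{..<x}| \<le>o |{..<m}|"
    and card_UNIV: "|{..<m}| <o |UNIV :: 'a set|"
    and cof_m: "is_cof le_rel m k"
    and k_less_m: "k < m"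
    and uncountable_k: "natLeq <o |{..<k}|"
begin

section \<open>Regularity and uncountability of \<kappa>\<close>

text \<open>By cardinality, \<omega> is isomorphic to a proper initial segment of \<open>k\<close>.
  The index \<open>c\<close> makes countable sets instances of the boundedness lemmas.\<close>

lemma ex_infinite_below_k:
  obtains c where "c < k" "|UNIV :: nat set| \<le>o |{..<c}|"
proof -
  have "well_order_on {..<k} (Restr le_rel {..<k})"
    by (rule well_order_on_Restr[OF Well_order_le_rel]) (simp add: Field_le_rel)
  then have "(natLeq, Restr le_rel {..<k}) \<in> ordLess"
    using uncountable_k card_of_least ordLess_ordLeq_trans by blast
  from ordLess_Restr_le_rel[OF this] obtain c where c: "c < k"
    "(natLeq, Restr le_rel ({..<k} \<inter> {..<c})) \<in> ordIso" by auto
  moreover from c(1) have "{..<k} \<inter> {..<c} = {..<c}" by auto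
  ultimately show ?thesis
    using card_of_cong[OF c(2)] that[of c] by (simp add: Field_natLeq ordIso_imp_ordLeq)
qed

lemma infinite_below_k: "\<not> finite {..<k}"
  using infinite_iff_natLeq_ordLeq[of "{..<k}"] ordLess_imp_ordLeq[OF uncountable_k] by simp

lemma infinite_below_m: "\<not> finite {..<m}"
proof -
  have "{..<k} \<subseteq> {..<m}" using k_less_m by auto
  then show ?thesis using infinite_below_k finite_subset by blast
qed

text \<open>Regularity of \<open>k\<close> comes from \<open>m\<close>: after composition with an
  increasing cofinal \<open>e\<close> from \<open>k\<close> to \<open>m\<close>, the values are
  bounded by some \<open>e i\<close>, and then \<open>i\<close> bounds \<open>f\<close>.\<close>

lemma bounded_below_k:
  assumes f: "f ` J \<subseteq> {..<k}" and J: "|J| \<le>o |{..<c}|" "c < k"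
  shows "\<exists>u<k. \<forall>j\<in>J. f j < u"
proof -
  obtain e where e: "\<forall>x<k. \<forall>y<k. x < y \<longrightarrow> e x < e y" "e ` {..<k} \<subseteq> {..<m}"
    "unbounded_in le_rel (e ` {..<k}) m"
    using cof_m unfolding is_cof_def cof_type_le_rel by blast
  obtain u where u: "u < m" "\<forall>j\<in>J. e (f j) < u"
    using is_cof_bounded[OF cof_m _ J, of "e \<circ> f"] e(2) f by fastforce
  then obtain i where i: "i < k" "u \<le> e i" using e(3) by (auto simp: unbounded_in_le_rel)
  have "f j < i" if "j \<in> J" for j
  proof (rule ccontr)
    assume "\<not> f j < i"
    then have "e i \<le> e (f j)" using e(1) i(1) f that by (fastforce simp: not_less le_less)
    with u(2) i(2) that show False by (meson less_le_trans not_less order_trans)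
  qed
  with i(1) show ?thesis by blast
qed

lemma ex_between_k: "i < k \<Longrightarrow> \<exists>j>i. j < k"
proof -
  assume i: "i < k"
  obtain c where c: "c < k" "|UNIV :: nat set| \<le>o |{..<c}|" by (rule ex_infinite_below_k)
  have "|{i}| \<le>o |UNIV :: nat set|" by (rule card_of_singl_ordLeq) simp
  then have "|{i}| \<le>o |{..<c}|" using c(2) by (rule ordLeq_transitive)
  from bounded_below_k[OF _ this c(1), of id] i show ?thesis by auto
qed

section \<open>Filtrations and cofinal sets\<close>

text \<open>Each \<open>b\<close> injects into \<open>m\<close>; the piece \<open>a b i\<close>
  consists of the points sent below \<open>e i\<close>, for one fixed map \<open>e\<close> cofinal
  in \<open>m\<close>. This is why the size bound does not depend on \<open>b\<close>.\<close>

lemma ex_filtration: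
  obtains a :: "'a \<Rightarrow> 'a \<Rightarrow> 'a set" and e :: "'a \<Rightarrow> 'a"
  where "\<And>b i. a b i \<subseteq> {..<b}"
    and "\<And>b i j. i \<le> j \<Longrightarrow> j < k \<Longrightarrow> a b i \<subseteq> a b j"
    and "\<And>b x. x < b \<Longrightarrow> \<exists>i<k. x \<in> a b i"
    and "\<And>i. i < k \<Longrightarrow> e i < m"
    and "\<And>b i. i < k \<Longrightarrow> |a b i| \<le>o |{..<e i}|"
proof -
  obtain e where e: "\<forall>x<k. \<forall>y<k. x < y \<longrightarrow> e x < e y" "e ` {..<k} \<subseteq> {..<m}"
    "unbounded_in le_rel (e ` {..<k}) m"
    using cof_m unfolding is_cof_def cof_type_le_rel by blast
  have "\<forall>b. \<exists>f. inj_on f {..<b} \<and> f ` {..<b} \<subseteq> {..<m}"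
    using card_below card_of_ordLeq by blast
  then obtain f where f: "\<And>b. inj_on (f b) {..<b}" "\<And>b. f b ` {..<b} \<subseteq> {..<m}" by metis
  define a where "a b i = {x. x < b \<and> f b x < e i}" for b i
  show ?thesis
  proof (rule that[of a e])
    show "a b i \<subseteq> {..<b}" for b i by (auto simp: a_def)
    show "a b i \<subseteq> a b j" if "i \<le> j" "j < k" for b i j
    proof -
      have "e i \<le> e j" using e(1) that by (cases "i = j") (auto simp: le_less intro: less_trans)
      then show ?thesis by (auto simp: a_def intro: less_le_trans)
    qed
    show "\<exists>i<k. x \<in> a b i" if "x < b" for b x
    proof -
      have "f b x < m" using f(2) that by blast
      then obtain i where i: "i < k" "f b x \<le> e i" using e(3) by (auto simp: unbounded_in_le_rel)
      \<comment> \<open>Cofinality only yields \<open>f b x \<le> e i\<close>, while membership in a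
        piece is strict; a larger index repairs this.\<close>
      then obtain j where "i < j" "j < k" using ex_between_k by blast
      then show ?thesis using i e(1) that by (auto simp: a_def intro!: exI[of _ j] intro: le_less_trans)
    qed
    show "e i < m" if "i < k" for i using e(2) that by blast
    show "|a b i| \<le>o |{..<e i}|" for b i
      by (rule card_of_ordLeqI[of "f b"])
        (use f(1)[of b] in \<open>auto simp: a_def intro: inj_on_subset\<close>)
  qed
qed

text \<open>If every piece were bounded, the bounds \<open>g i\<close> would be cofinal in
  \<open>d\<close>. Then \<open>d\<close> would have a cofinal type at most \<open>k\<close>, and it
  remains to exclude types below \<open>k\<close>.\<close>

lemma unbounded_filtration_piece:
  assumes lim: "is_limit le_rel d" and nc: "\<not> is_cof le_rel d k"
    and A: "unbounded_in le_rel (A \<inter> {..<d}) d"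
    and mono: "\<And>i j. i \<le> j \<Longrightarrow> j < k \<Longrightarrow> a i \<subseteq> a j"
    and cover: "\<And>x. x < d \<Longrightarrow> \<exists>i<k. x \<in> a i"
  shows "\<exists>i<k. unbounded_in le_rel (A \<inter> a i) d"
proof (rule ccontr)
  assume "\<not> ?thesis"
  then have "\<forall>i. \<exists>b. i < k \<longrightarrow> b < d \<and> (\<forall>x\<in>A \<inter> a i. x < b)"
    unfolding unbounded_in_le_rel by (auto simp: not_le)
  then obtain g where g: "\<And>i. i < k \<Longrightarrow> g i < d" "\<And>i x. i < k \<Longrightarrow> x \<in> A \<inter> a i \<Longrightarrow> x < g i"
    by metis
  have ex: "\<exists>i<k. \<exists>x\<in>A \<inter> a i. b \<le> x" if "b < d" for b
    using A cover that unfolding unbounded_in_le_rel by blast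
  have "unbounded_in le_rel (g ` {..<k}) d"
    unfolding unbounded_in_le_rel
  proof (intro allI impI)
    fix b assume "b < d"
    from ex[OF this] obtain i x where "i < k" "x \<in> A \<inter> a i" "b \<le> x" by blast
    with g(2) show "\<exists>y\<in>g ` {..<k}. b \<le> y" by (fastforce intro: less_imp_le le_less_trans)
  qed
  then obtain c where c: "c \<le> k" "cof_type le_rel d c"
    using cof_type_of_unbounded_image[of g k d] g(1) by auto
  \<comment> \<open>Each term of a shorter cofinal sequence is reached inside some piece. By
    regularity the indices used lie below one \<open>u\<close>, so \<open>A \<inter> a u\<close>
    would be cofinal although \<open>g u\<close> bounds it.\<close>
  have small: "\<not> cof_type le_rel d c" if "c < k" for c
  proof
    assume "cof_type le_rel d c"
    then obtain e where e: "e ` {..<c} \<subseteq> {..<d}" "unbounded_in le_rel (e ` {..<c}) d"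
      unfolding cof_type_le_rel by blast
    have "\<forall>l. \<exists>i. l < c \<longrightarrow> i < k \<and> (\<exists>x\<in>A \<inter> a i. e l \<le> x)"
      using ex e(1) by blast
    then obtain f where f: "\<And>l. l < c \<Longrightarrow> f l < k" "\<And>l. l < c \<Longrightarrow> \<exists>x\<in>A \<inter> a (f l). e l \<le> x"
      by metis
    have "f ` {..<c} \<subseteq> {..<k}" using f(1) by auto
    from bounded_below_k[OF this ordLeq_reflexive[OF card_of_Well_order] that]
    obtain u where u: "u < k" "\<And>l. l < c \<Longrightarrow> f l < u" by auto
    obtain l where l: "l < c" "g u \<le> e l" using e(2) g(1)[OF u(1)] by (auto simp: unbounded_in_le_rel)
    obtain x where "x \<in> A \<inter> a (f l)" "e l \<le> x" using f(2)[OF l(1)] by blast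
    moreover from this have "x < g u" using g(2)[OF u(1)] mono[OF less_imp_le[OF u(2)[OF l(1)]] u(1)] by blast
    ultimately show False using l(2) by (meson le_less_trans not_less order_trans)
  qed
  have "c = k" using c small by (auto simp: le_less)
  with c small nc show False by (auto simp: is_cof_def)
qed

text \<open>\<open>X\<close> is the range of an increasing cofinal map \<open>e\<close>. Between two
  limit points lies a value of \<open>e\<close>, so the index \<open>p b\<close> at which
  \<open>e\<close> first reaches \<open>b\<close> determines a limit point \<open>b\<close>;
  counting indices gives the cardinality bounds.\<close>

lemma ex_cofinal_set:
  assumes d: "is_cof le_rel d k"
  obtains X where "X \<subseteq> {..<d}" "unbounded_in le_rel X d"
    "\<And>b. b \<in> limit_points X \<inter> {..<d} \<Longrightarrow> \<not> is_cof le_rel b k"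
    "|limit_points X \<inter> {..<d}| \<le>o |{..<k}|"
    "\<And>b. b < d \<Longrightarrow> \<exists>c<k. |limit_points X \<inter> {..<d} \<inter> {..b}| \<le>o |{..<c}|"
proof -
  obtain e where e: "\<forall>x<k. \<forall>y<k. x < y \<longrightarrow> e x < e y" "e ` {..<k} \<subseteq> {..<d}"
    "unbounded_in le_rel (e ` {..<k}) d"
    using d unfolding is_cof_def cof_type_le_rel by blast
  have e_less: "x < y" if "x < k" "y < k" "e x < e y" for x y
  proof (rule linorder_cases[of x y])
    assume "y < x"
    then show ?thesis using e(1) that by (blast dest: less_asym)
  qed (use that(3) in simp_all)
  define X where "X = e ` {..<k}"
  define E where "E = limit_points X \<inter> {..<d}"
  define p where "p b = (LEAST i. i < k \<and> b \<le> e i)" for b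
  have p: "p b < k \<and> b \<le> e (p b)" if "b < d" for b
  proof -
    have "\<exists>i. i < k \<and> b \<le> e i" using e(3) that by (auto simp: unbounded_in_le_rel)
    then show ?thesis unfolding p_def by (rule LeastI_ex[of "\<lambda>i. i < k \<and> b \<le> e i"])
  qed
  have p_le: "p b \<le> i" if "i < k" "b \<le> e i" for b i
    unfolding p_def using that by (intro Least_le conjI)
  have below_p: "i < p b" if "i < k" "e i < b" "b < d" for i b
    using e_less[of i "p b"] p[OF that(3)] that by (auto intro: less_le_trans)
  have mono: "p b < p b'" if b: "b \<in> E" "b' \<in> E" "b < b'" for b b'
  proof -
    obtain i where "i < k" "b \<le> e i" "e i < b'"
      using b limit_pointsD[of b' X b] by (auto simp: E_def X_def)
    moreover have "b' < d" using that by (simp add: E_def)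
    ultimately show ?thesis using p_le[of i b] below_p[of i b'] by simp
  qed
  have inj: "inj_on p E"
    by (rule inj_onI) (metis mono less_irrefl linorder_cases)
  show ?thesis
  proof (rule that[of X])
    show "X \<subseteq> {..<d}" "unbounded_in le_rel X d" using e by (auto simp: X_def)
    show "\<not> is_cof le_rel b k" if lp: "b \<in> limit_points X \<inter> {..<d}" for b
    proof
      \<comment> \<open>The values of \<open>e\<close> at indices before \<open>p b\<close> lie
        below \<open>b\<close> and are fewer than \<open>k\<close>, so some \<open>u < b\<close>
        would bound them; a limit point has values of \<open>e\<close> between \<open>u\<close> and
        \<open>b\<close>.\<close>
      assume b: "is_cof le_rel b k"
      have bd: "b < d" using that by auto
      have "e ` {..<p b} \<subseteq> {..<b}"
      proof (intro image_subsetI)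
        fix i assume "i \<in> {..<p b}"
        then show "e i \<in> {..<b}"
          using p_le[of i b] p[OF bd] unfolding lessThan_iff by (meson less_trans not_le)
      qed
      from is_cof_bounded[OF b this ordLeq_reflexive[OF card_of_Well_order]] p[OF bd]
      obtain u where u: "u < b" "\<And>i. i < p b \<Longrightarrow> e i < u" by auto
      obtain i where "i < k" "u \<le> e i" "e i < b"
        using lp u(1) limit_pointsD[of b X u] by (auto simp: X_def)
      with u(2)[OF below_p[of i b]] bd show False by simp
    qed
    show "|limit_points X \<inter> {..<d}| \<le>o |{..<k}|"
      by (rule card_of_ordLeqI[OF inj[unfolded E_def]]) (use p in auto)
    show "\<exists>c<k. |limit_points X \<inter> {..<d} \<inter> {..b}| \<le>o |{..<c}|" if b: "b < d" for b
    proof -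
      \<comment> \<open>On the closed segment up to \<open>b\<close> the map \<open>p\<close> may
        attain \<open>p b\<close> itself, so \<open>c\<close> must lie strictly beyond it.\<close>
      obtain c where c: "p b < c" "c < k" using ex_between_k p[OF b] by blast
      have "|E \<inter> {..b}| \<le>o |{..<c}|"
      proof (rule card_of_ordLeqI)
        show "inj_on p (E \<inter> {..b})" using inj by (rule inj_on_subset) auto
        show "p x \<in> {..<c}" if "x \<in> E \<inter> {..b}" for x
          using p_le[of "p b" x] p[OF \<open>b < d\<close>] that c(1) by (auto intro: order_trans le_less_trans)
      qed
      with c(2) show ?thesis by (auto simp: E_def)
    qed
  qed
qed

text \<open>Regularity of the successor of \<mu>: an unbounded \<open>J\<close> would cover the
  whole type by at most \<mu> sets of size at most \<mu>.\<close>

lemma bounded_of_card_le: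
  fixes J :: "'a set"
  assumes "|J| \<le>o |{..<m}|" shows "\<exists>u. \<forall>x\<in>J. x < u"
proof (rule ccontr)
  assume "\<not> ?thesis"
  then have "\<forall>u. \<exists>x\<in>J. u \<le> x" by (auto simp: not_less)
  then have "UNIV \<subseteq> J \<union> (\<Union>x\<in>J. {..<x})" by (auto simp: le_less)
  then have "|UNIV :: 'a set| \<le>o |J \<union> (\<Union>x\<in>J. {..<x})|" by (rule card_of_mono1)
  also have "|J \<union> (\<Union>x\<in>J. {..<x})| \<le>o |{..<m}|"
    by (rule card_of_Un_ordLeq_infinite_Field[OF _ assms _ card_of_Card_order])
      (use infinite_below_m assms card_below in
        \<open>auto simp: Field_card_of intro!: card_of_UNION_ordLeq_infinite\<close>)
  finally show False using card_UNIV not_ordLess_ordLeq by blast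
qed

text \<open>\<open>A\<close> is too large to fit below any point, so closure points of
  \<open>R\<close> exist, and they are limit points of \<open>A\<close>. The cut at \<open>m\<close>
  is made because the guessing families will be empty below \<open>m\<close>.\<close>

lemma club_limit_points:
  assumes A: "|A| =o |UNIV :: 'a set|"
  shows "club le_rel (limit_points A \<inter> {m..})"
  unfolding club_def
proof (intro conjI allI impI)
  fix b
  define R where "R b c \<longleftrightarrow> (\<exists>x\<in>A. b \<le> x \<and> x < c)" for b c
  have bnd: "\<exists>u\<in>UNIV. \<forall>n. F n \<le> u" for F :: "nat \<Rightarrow> 'a"
  proof -
    have "|range F| \<le>o |UNIV :: nat set|" by (rule card_of_image)
    also have "|UNIV :: nat set| \<le>o |{..<m}|" using infinite_below_m infinite_iff_card_of_nat by blast
    finally show ?thesis using bounded_of_card_le by (fastforce intro: less_imp_le)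
  qed
  have step: "\<exists>c\<in>UNIV. b < c \<and> R b c" for b
  proof -
    have "\<not> A \<subseteq> {..<b}"
    proof
      assume "A \<subseteq> {..<b}"
      then have "|A| \<le>o |{..<b}|" by (rule card_of_mono1)
      then have "|A| \<le>o |{..<m}|" using card_below ordLeq_transitive by blast
      then have "|A| <o |UNIV :: 'a set|" using card_UNIV ordLeq_ordLess_trans by blast
      with A show False using not_ordLess_ordIso by blast
    qed
    then obtain x where x: "x \<in> A" "b \<le> x" unfolding subset_eq lessThan_iff by (meson not_less)
    have "{..<m} \<noteq> {}" using k_less_m by auto
    then have "|{x}| \<le>o |{..<m}|" by (rule card_of_singl_ordLeq)
    from bounded_of_card_le[OF this] obtain c where "x < c" by auto
    with x show ?thesis by (auto simp: R_def intro: le_less_trans)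
  qed
  obtain a where a: "max b m < a" "is_limit le_rel a" "\<And>b'. b' < a \<Longrightarrow> \<exists>c<a. b' < c \<and> R b' c"
    by (rule ex_closure_point[of UNIV R "max b m", OF bnd _ step])
      (auto simp: R_def intro: order_trans)
  have "a \<in> limit_points A"
    using a(2,3) by (fastforce simp: limit_points_def unbounded_in_le_rel R_def intro: less_trans)
  with a(1) show "\<exists>c\<in>limit_points A \<inter> {m..}. (b, c) \<in> le_rel"
    by (auto intro!: bexI[of _ a] intro: less_imp_le)
next
  fix a
  assume "is_limit le_rel a \<and> unbounded_in le_rel (limit_points A \<inter> {m..} \<inter> underS le_rel a) a"
  then have lim: "is_limit le_rel a" and
    unb: "\<And>b. b < a \<Longrightarrow> \<exists>x\<in>limit_points A \<inter> {m..} \<inter> {..<a}. b \<le> x"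
    by (auto simp: unbounded_in_le_rel)
  have "a \<in> limit_points A"
    by (rule limit_points_closed[OF lim]) (use unb in \<open>fastforce simp: unbounded_in_le_rel\<close>)
  moreover obtain b where "b < a" using lim by (auto simp: is_limit_le_rel)
  then have "m \<le> a" using unb by (fastforce intro: order_trans less_imp_le)
  ultimately show "a \<in> limit_points A \<inter> {m..}" by simp
qed


section \<open>The guessing families\<close>

text \<open>One family serves all four principles. The bound \<open>w < m\<close> later gives order
  types below \<open>m\<close> and, for strong limit \<open>m\<close>, power sets smaller than
  \<open>m\<close>.\<close>

lemma ex_guessing_family:
  obtains P :: "'a \<Rightarrow> 'a set set"
  where "\<And>d. |P d| \<le>o |{..<d}|"
    and "\<And>d B. B \<in> P d \<Longrightarrow> m \<le> d \<and> B \<subseteq> {..<d} \<and> unbounded_in le_rel B d \<and>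
      (\<exists>w<m. |B| \<le>o |{..<w}| )"
    and "\<And>A d. d \<in> limit_points A \<Longrightarrow> m \<le> d \<Longrightarrow> \<not> is_cof le_rel d k \<Longrightarrow>
      \<exists>B\<in>P d. unbounded_in le_rel (B \<inter> A) d"
    and "\<And>A. {d \<in> limit_points A. m \<le> d \<and> is_cof le_rel d k \<and>
        \<not> (\<exists>B\<in>P d. unbounded_in le_rel (B \<inter> A) d)} \<in> I_lk le_rel k"
proof -
  obtain a e where a: "\<And>b i. a b i \<subseteq> {..<b}"
    and a_mono: "\<And>b i j. i \<le> j \<Longrightarrow> j < k \<Longrightarrow> a b i \<subseteq> a b j"
    and a_cover: "\<And>b x. x < b \<Longrightarrow> \<exists>i<k. x \<in> a b i"
    and e: "\<And>i. i < k \<Longrightarrow> e i < m"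
    and a_card: "\<And>b i. i < k \<Longrightarrow> |a b i| \<le>o |{..<e i}|"
    by (rule ex_filtration) (rule that; assumption)
  define T where "T d X \<longleftrightarrow> X \<subseteq> {..<d} \<and> unbounded_in le_rel X d \<and>
      (\<forall>b\<in>limit_points X \<inter> {..<d}. \<not> is_cof le_rel b k) \<and>
      |limit_points X \<inter> {..<d}| \<le>o |{..<k}| \<and>
      (\<forall>b<d. \<exists>c<k. |limit_points X \<inter> {..<d} \<inter> {..b}| \<le>o |{..<c}| )" for d X
  have "\<exists>X. T d X" if "is_cof le_rel d k" for d
    unfolding T_def by (rule ex_cofinal_set[OF that]) blast
  then obtain X where "\<And>d. is_cof le_rel d k \<Longrightarrow> T d (X d)" by metis
  then have X: "\<And>d. is_cof le_rel d k \<Longrightarrow> X d \<subseteq> {..<d}"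
    "\<And>d. is_cof le_rel d k \<Longrightarrow> unbounded_in le_rel (X d) d"
    "\<And>d b. is_cof le_rel d k \<Longrightarrow> b \<in> limit_points (X d) \<inter> {..<d} \<Longrightarrow> \<not> is_cof le_rel b k"
    "\<And>d. is_cof le_rel d k \<Longrightarrow> |limit_points (X d) \<inter> {..<d}| \<le>o |{..<k}|"
    "\<And>d b. is_cof le_rel d k \<Longrightarrow> b < d \<Longrightarrow>
      \<exists>c<k. |limit_points (X d) \<inter> {..<d} \<inter> {..b}| \<le>o |{..<c}|"
    unfolding T_def by blast+
  define B where "B d i = (if is_cof le_rel d k
    then \<Union>b\<in>limit_points (X d) \<inter> {..<d}. a b i else a d i)" for d i
  \<comment> \<open>For \<open>m \<le> d\<close> the at most \<open>k\<close> many candidates number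
    at most \<open>|d|\<close>. Those bounded in \<open>d\<close> are discarded.\<close>
  define P where "P d = {B d i |i. i < k \<and> m \<le> d \<and> unbounded_in le_rel (B d i) d}" for d
  have PI: "\<exists>B\<in>P d. unbounded_in le_rel (B \<inter> A) d"
    if "i < k" "m \<le> d" "unbounded_in le_rel (B d i \<inter> A) d" for d i A
  proof
    have "unbounded_in le_rel (B d i) d" using that(3) by (rule unbounded_in_mono) simp
    with that show "B d i \<in> P d" by (auto simp: P_def)
  qed (rule that(3))
  show ?thesis
  proof (rule that[of P])
    fix d
    show "|P d| \<le>o |{..<d}|"
    proof (cases "m \<le> d")
      case True
      have "P d \<subseteq> B d ` {..<k}" by (auto simp: P_def)
      then have "|P d| \<le>o |B d ` {..<k}|" by (rule card_of_mono1)
      also have "|B d ` {..<k}| \<le>o |{..<k}|" by (rule card_of_image)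
      also have "|{..<k}| \<le>o |{..<d}|"
        by (rule card_of_mono1) (use True k_less_m in \<open>auto intro: less_trans less_le_trans\<close>)
      finally show ?thesis .
    next
      case False
      then have "P d = {}" by (auto simp: P_def)
      then show ?thesis by (simp add: card_of_empty)
    qed
  next
    fix d C assume "C \<in> P d"
    then obtain i where i: "C = B d i" "i < k" "m \<le> d" "unbounded_in le_rel (B d i) d"
      unfolding P_def by blast
    have "B d i \<subseteq> {..<d}"
    proof
      fix x assume "x \<in> B d i"
      then obtain b where "b \<le> d" "x \<in> a b i" by (auto simp: B_def dest: less_imp_le split: if_splits)
      then show "x \<in> {..<d}" using a[of b i] by (auto intro: less_le_trans)
    qed
    moreover have "\<exists>w<m. |B d i| \<le>o |{..<w}|"
    proof (cases "is_cof le_rel d k")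
      case True
      \<comment> \<open>This bounds both the number of sets in the union and the size of
        each.\<close>
      define w where "w = max k (e i)"
      have le: "|{..<v}| \<le>o |{..<w}|" if "v \<le> w" for v
        by (rule card_of_mono1) (use that in \<open>auto intro: less_le_trans\<close>)
      have inf: "\<not> finite {..<w}"
        using infinite_below_k card_of_ordLeq_infinite[OF le[of k]] by (simp add: w_def)
      have "|B d i| \<le>o |{..<w}|"
        unfolding B_def if_P[OF True]
      proof (rule card_of_UNION_ordLeq_infinite[OF inf])
        show "|limit_points (X d) \<inter> {..<d}| \<le>o |{..<w}|"
          using ordLeq_transitive[OF X(4)[OF True] le[of k]] by (simp add: w_def)
        show "\<forall>b\<in>limit_points (X d) \<inter> {..<d}. |a b i| \<le>o |{..<w}|"
          using ordLeq_transitive[OF a_card[OF i(2)] le[of "e i"]] by (simp add: w_def)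
      qed
      moreover have "w < m" using e[OF i(2)] k_less_m by (simp add: w_def)
      ultimately show ?thesis by blast
    next
      case False
      then show ?thesis using e[OF i(2)] a_card[OF i(2)] by (auto simp: B_def)
    qed
    ultimately show "m \<le> d \<and> C \<subseteq> {..<d} \<and> unbounded_in le_rel C d \<and> (\<exists>w<m. |C| \<le>o |{..<w}| )"
      using i by blast
  next
    fix A d assume d: "d \<in> limit_points A" "m \<le> d" "\<not> is_cof le_rel d k"
    then have "\<exists>i<k. unbounded_in le_rel (A \<inter> a d i) d"
      by (intro unbounded_filtration_piece) (auto simp: limit_points_def a_cover a_mono subsetD[OF a_mono])
    then obtain i where "i < k" "unbounded_in le_rel (B d i \<inter> A) d"
      using d(3) by (auto simp: B_def Int_commute)
    then show "\<exists>B\<in>P d. unbounded_in le_rel (B \<inter> A) d" using PI d(2) by blast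
  next
    fix A
    \<comment> \<open>\<open>I_lk\<close> wants a total map into \<open>k\<close>, so points where
      no piece works get an arbitrary value below \<open>k\<close>.\<close>
    define h where "h b = (if \<exists>i<k. unbounded_in le_rel (A \<inter> a b i) b
      then SOME i. i < k \<and> unbounded_in le_rel (A \<inter> a b i) b else SOME i. i < k)" for b
    obtain c\<^sub>0 where c\<^sub>0: "c\<^sub>0 < k" "|UNIV :: nat set| \<le>o |{..<c\<^sub>0}|" by (rule ex_infinite_below_k)
    have h: "h b < k \<and> ((\<exists>i<k. unbounded_in le_rel (A \<inter> a b i) b) \<longrightarrow>
        unbounded_in le_rel (A \<inter> a b (h b)) b)" for b
    proof (cases "\<exists>i<k. unbounded_in le_rel (A \<inter> a b i) b")
      case True
      then show ?thesis unfolding h_def if_P[OF True]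
        using someI_ex[of "\<lambda>i. i < k \<and> unbounded_in le_rel (A \<inter> a b i) b"] by blast
    next
      case False
      then show ?thesis unfolding h_def if_not_P[OF False] using someI[of "\<lambda>i. i < k", OF c\<^sub>0(1)] by blast
    qed
    have "\<exists>C. club_of le_rel C d \<and> (\<forall>x\<in>C. \<forall>y\<in>C. olt le_rel x y \<longrightarrow> olt le_rel (h x) (h y))"
      if dA: "d \<in> limit_points A" and md: "m \<le> d" and cof: "is_cof le_rel d k"
        and bad: "\<not> (\<exists>B\<in>P d. unbounded_in le_rel (B \<inter> A) d)" for d
    proof -
      define E where "E = limit_points (X d) \<inter> {..<d}"
      have Bd: "a b i \<subseteq> B d i" if "b \<in> E" for b i
        using that cof by (auto simp: B_def E_def)
      have "\<forall>i. \<exists>b. i < k \<longrightarrow> b < d \<and> (\<forall>x\<in>B d i \<inter> A. x < b)"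
        using PI[OF _ md, of _ A] bad unfolding unbounded_in_le_rel by (meson not_le)
      then obtain g where g: "\<And>i. i < k \<Longrightarrow> g i < d"
        "\<And>i x. i < k \<Longrightarrow> x \<in> B d i \<Longrightarrow> x \<in> A \<Longrightarrow> x < g i" by (metis IntI)
      \<comment> \<open>If \<open>h b \<le> i\<close>, then \<open>A \<inter> a b (h b)\<close>,
        unbounded in \<open>b\<close>, would be part of \<open>B d i \<inter> A\<close>, which
        \<open>g i < b\<close> bounds.\<close>
      have h_above: "i < h b" if b: "b \<in> E" "b \<in> limit_points A" and i: "i < k" "g i < b" for b i
      proof (rule ccontr)
        assume "\<not> i < h b"
        then have "h b \<le> i" by simp
        have "\<exists>i<k. unbounded_in le_rel (A \<inter> a b i) b"
          using b X(3)[OF cof, of b] unfolding E_def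
          by (intro unbounded_filtration_piece) (auto simp: limit_points_def a_cover subsetD[OF a_mono])
        with h have "unbounded_in le_rel (A \<inter> a b (h b)) b" by blast
        then obtain x where "x \<in> A" "x \<in> a b (h b)" "g i \<le> x"
          using i(2) by (auto simp: unbounded_in_le_rel)
        moreover from this have "x \<in> B d i"
          using a_mono[OF \<open>h b \<le> i\<close> i(1)] Bd[OF b(1)] by blast
        ultimately show False using g(2)[OF i(1), of x] by simp
      qed
      \<comment> \<open>Closure under the first two clauses makes a point a limit of
        \<open>X d\<close> and of \<open>A\<close>; the third closes it under \<open>g\<close> after
        \<open>h\<close> on \<open>E\<close>.\<close>
      define R where "R b c \<longleftrightarrow> (\<exists>x\<in>X d. b \<le> x \<and> x < c) \<and> (\<exists>x\<in>A. b \<le> x \<and> x < c) \<and>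
        (\<forall>y\<in>E. y \<le> b \<longrightarrow> g (h y) < c)" for b c
      define C where "C = {b. b < d \<and> is_limit le_rel b \<and> (\<forall>b'<b. \<exists>c<b. b' < c \<and> R b' c)}"
      have lim: "is_limit le_rel d" using dA by (simp add: limit_points_def)
      have step: "\<exists>c\<in>{..<d}. b < c \<and> R b c" if "b \<in> {..<d}" for b
      proof -
        have b: "b < d" using that by simp
        obtain x where x: "x \<in> X d" "b \<le> x" "x < d"
          using X(1,2)[OF cof] b unfolding unbounded_in_le_rel by blast
        obtain y where y: "y \<in> A" "b \<le> y" "y < d" using limit_pointsD[OF dA b] by blast
        \<comment> \<open>\<open>E\<close> has fewer than \<open>k\<close> points up to
          \<open>b\<close>, so the values \<open>g (h y)\<close> there are bounded below
          \<open>d\<close>.\<close>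
        obtain c where "c < k" "|E \<inter> {..b}| \<le>o |{..<c}|" using X(5)[OF cof b] by (auto simp: E_def)
        then obtain u where u: "u < d" "\<forall>y\<in>E \<inter> {..b}. g (h y) < u"
          using is_cof_bounded[OF cof, of "\<lambda>y. g (h y)" "E \<inter> {..b}" c] g(1) h by auto
        have "max (max x y) u < d" using x y u by simp
        then obtain v where "v < d" "max (max x y) u < v"
          using lim unfolding is_limit_le_rel by blast
        then show ?thesis using x y u(2)
          by (intro bexI[of _ v]) (auto simp: R_def intro: le_less_trans less_trans)
      qed
      have bnd: "\<exists>u\<in>{..<d}. \<forall>n. F n \<le> u" if "range F \<subseteq> {..<d}" for F :: "nat \<Rightarrow> 'a"
        using is_cof_bounded[OF cof that c\<^sub>0(2,1)] by (auto intro: less_imp_le)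
      have C_unb: "\<exists>c\<in>C. b \<le> c" if "b < d" for b
      proof -
        obtain c where "c < d" "b < c" "is_limit le_rel c"
          "\<And>b'. b' < c \<Longrightarrow> \<exists>v<c. b' < v \<and> R b' v"
        proof (rule ex_closure_point[of "{..<d}" R b, OF bnd _ step])
          show "R b' c" if "b' \<le> b" "R b c" for b' b c
            using that unfolding R_def by (meson order_trans)
        qed (use \<open>b < d\<close> in \<open>auto intro: le_less_trans\<close>)
        then show ?thesis by (auto simp: C_def intro!: bexI[of _ c] intro: less_imp_le)
      qed
      have C_closed: "b \<in> C" if b: "b < d" "is_limit le_rel b"
        "unbounded_in le_rel (C \<inter> {..<b}) b" for b
      proof -
        have "\<exists>c<b. b' < c \<and> R b' c" if "b' < b" for b'
        proof -
          obtain v where v: "b' < v" "v < b" using \<open>b' < b\<close> b(2) unfolding is_limit_le_rel by blast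
          then obtain z where z: "z \<in> C" "z < b" "v \<le> z" using b(3) unfolding unbounded_in_le_rel by blast
          then have "b' < z" using v by simp
          then obtain c where "c < z" "b' < c" "R b' c" using z(1) by (auto simp: C_def)
          then show ?thesis using z(2) by (blast intro: less_trans)
        qed
        then show ?thesis using b by (simp add: C_def)
      qed
      have C_mem: "b \<in> E \<and> b \<in> limit_points A" if b: "b \<in> C" for b
      proof -
        have b': "b < d" "is_limit le_rel b" "\<And>b'. b' < b \<Longrightarrow> \<exists>c<b. b' < c \<and> R b' c"
          using b by (auto simp: C_def)
        have "b \<in> limit_points (X d)" "b \<in> limit_points A"
          by (intro limit_pointsI[OF b'(2)]; use b'(3) in \<open>fastforce simp: R_def intro: less_trans\<close>)+
        with b'(1) show ?thesis by (simp add: E_def)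
      qed
      have "club_of le_rel C d"
        unfolding club_of_def using C_unb C_closed
        by (auto simp: unbounded_in_le_rel C_def)
      \<comment> \<open>Closure of \<open>y\<close> gives \<open>g (h x) < y\<close>, and
        \<open>h_above\<close> applies with \<open>i = h x\<close>.\<close>
      moreover have "h x < h y" if xy: "x \<in> C" "y \<in> C" "x < y" for x y
      proof -
        obtain c where "c < y" "R x c" using xy by (auto simp: C_def)
        then have "g (h x) < y" using C_mem[OF xy(1)] unfolding R_def by (blast intro: less_trans)
        then show ?thesis using C_mem[OF xy(2)] h h_above by blast
      qed
      ultimately show ?thesis by auto
    qed
    then show "{d \<in> limit_points A. m \<le> d \<and> is_cof le_rel d k \<and>
        \<not> (\<exists>B\<in>P d. unbounded_in le_rel (B \<inter> A) d)} \<in> I_lk le_rel k"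
      unfolding I_lk_def S_cf_def using h by (intro CollectI exI[of _ h]) auto
  qed
qed

section \<open>From the families to the four principles\<close>

text \<open>At a limit, having supremum \<open>d\<close> and being unbounded in \<open>d\<close>
  agree for sets below \<open>d\<close>. The exceptional set at cofinality \<open>k\<close> thus
  equals the one placed in the ideal.\<close>

lemma clubsuit_minus_and_ideal:
  "clubsuit_minus le_rel m (UNIV - S_cf le_rel k) \<and>
   clubsuit_minus_ideal le_rel m (S_cf le_rel k) (I_lk le_rel k)"
proof -
  obtain P where P: "\<And>d. |P d| \<le>o |{..<d}|"
    "\<And>d B. B \<in> P d \<Longrightarrow> m \<le> d \<and> B \<subseteq> {..<d} \<and> unbounded_in le_rel B d \<and> (\<exists>w<m. |B| \<le>o |{..<w}| )"
    and guess: "\<And>A d. d \<in> limit_points A \<Longrightarrow> m \<le> d \<Longrightarrow> \<not> is_cof le_rel d k \<Longrightarrow>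
      \<exists>B\<in>P d. unbounded_in le_rel (B \<inter> A) d"
    and ideal: "\<And>A. {d \<in> limit_points A. m \<le> d \<and> is_cof le_rel d k \<and>
        \<not> (\<exists>B\<in>P d. unbounded_in le_rel (B \<inter> A) d)} \<in> I_lk le_rel k"
    by (rule ex_guessing_family) (rule that; assumption)
  have fam: "fam_minus le_rel m d (P d)" for d
    unfolding fam_minus_def underS_le_rel
    using P Restr_ordLess_of_card ordLeq_ordLess_trans[OF _ cardinal_m] by blast
  have G: "d \<in> G_minus le_rel P A \<longleftrightarrow> (\<exists>B\<in>P d. unbounded_in le_rel (B \<inter> A) d)"
    if "is_limit le_rel d" for d A
    unfolding G_minus_def mem_Collect_eq
    by (rule bex_cong[OF refl], rule is_sup_iff_unbounded[OF that]) (use P(2) in blast)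
  have "\<exists>C. club le_rel C \<and> {d \<in> C \<inter> (UNIV - S_cf le_rel k). is_limit le_rel d} \<subseteq> G_minus le_rel P A"
    "\<exists>C. club le_rel C \<and> {d \<in> C \<inter> S_cf le_rel k. is_limit le_rel d} - G_minus le_rel P A \<in> I_lk le_rel k"
    if A: "|A| =o |UNIV :: 'a set|" for A
  proof -
    let ?C = "limit_points A \<inter> {m..}"
    have "{d \<in> ?C \<inter> (UNIV - S_cf le_rel k). is_limit le_rel d} \<subseteq> G_minus le_rel P A"
      using guess G by (auto simp: S_cf_def)
    moreover have "{d \<in> ?C \<inter> S_cf le_rel k. is_limit le_rel d} - G_minus le_rel P A =
      {d \<in> limit_points A. m \<le> d \<and> is_cof le_rel d k \<and>
        \<not> (\<exists>B\<in>P d. unbounded_in le_rel (B \<inter> A) d)}"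
      using G by (auto simp: S_cf_def limit_points_def)
    ultimately show "\<exists>C. club le_rel C \<and> {d \<in> C \<inter> (UNIV - S_cf le_rel k). is_limit le_rel d} \<subseteq> G_minus le_rel P A"
      "\<exists>C. club le_rel C \<and> {d \<in> C \<inter> S_cf le_rel k. is_limit le_rel d} - G_minus le_rel P A \<in> I_lk le_rel k"
      using club_limit_points[OF A] ideal[of A] by auto
  qed
  then show ?thesis
    unfolding clubsuit_minus_def clubsuit_minus_ideal_def using fam by blast
qed

text \<open>The families are enlarged to all unbounded subsets of their members. Each member has
  fewer than \<mu> subsets, so the size bound survives, and the trace \<open>B \<inter> A\<close>
  becomes a guess contained in \<open>A\<close>.\<close>

lemma clubsuit_star_and_ideal:
  assumes strong: "strong_limit le_rel m"
  shows "clubsuit_star le_rel (UNIV - S_cf le_rel k) \<and>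
   clubsuit_star_ideal le_rel (S_cf le_rel k) (I_lk le_rel k)"
proof -
  obtain P where P: "\<And>d. |P d| \<le>o |{..<d}|"
    "\<And>d B. B \<in> P d \<Longrightarrow> m \<le> d \<and> B \<subseteq> {..<d} \<and> unbounded_in le_rel B d \<and> (\<exists>w<m. |B| \<le>o |{..<w}| )"
    and guess: "\<And>A d. d \<in> limit_points A \<Longrightarrow> m \<le> d \<Longrightarrow> \<not> is_cof le_rel d k \<Longrightarrow>
      \<exists>B\<in>P d. unbounded_in le_rel (B \<inter> A) d"
    and ideal: "\<And>A. {d \<in> limit_points A. m \<le> d \<and> is_cof le_rel d k \<and>
        \<not> (\<exists>B\<in>P d. unbounded_in le_rel (B \<inter> A) d)} \<in> I_lk le_rel k"
    by (rule ex_guessing_family) (rule that; assumption)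
  define Q where "Q d = {B' \<in> \<Union>(Pow ` P d). unbounded_in le_rel B' d}" for d
  have fam: "fam_plain le_rel d (Q d)" for d
  proof -
    have "|Q d| \<le>o |{..<d}|"
    proof (cases "P d = {}")
      case True
      then show ?thesis by (simp add: Q_def card_of_empty)
    next
      case False
      then have "m \<le> d" using P(2) by blast
      then have le: "|{..<m}| \<le>o |{..<d}|" by (intro card_of_mono1) (auto intro: less_le_trans)
      have inf: "\<not> finite {..<d}" using card_of_ordLeq_infinite[OF le] infinite_below_m by blast
      have "\<forall>B\<in>P d. |Pow B| \<le>o |{..<d}|"
      proof
        fix B assume "B \<in> P d"
        then obtain w where w: "w < m" "|B| \<le>o |{..<w}|" using P(2) by blast
        from w(2) have "|Pow B| \<le>o |Pow {..<w}|" by (rule Pow_ordLeq_mono)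
        also have "|Pow {..<w}| <o |{..<m}|" using strong w(1) by (simp add: strong_limit_def)
        finally show "|Pow B| \<le>o |{..<d}|" using le ordLess_imp_ordLeq ordLeq_transitive by blast
      qed
      then have "|\<Union>(Pow ` P d)| \<le>o |{..<d}|" by (rule card_of_UNION_ordLeq_infinite[OF inf P(1)])
      moreover have "|Q d| \<le>o |\<Union>(Pow ` P d)|" by (rule card_of_mono1) (auto simp: Q_def)
      ultimately show ?thesis using ordLeq_transitive by blast
    qed
    then show ?thesis using P(2) by (fastforce simp: fam_plain_def Q_def)
  qed
  have G: "d \<in> G_plain Q A \<longleftrightarrow> (\<exists>B\<in>P d. unbounded_in le_rel (B \<inter> A) d)" for d A
  proof
    assume "d \<in> G_plain Q A"
    then obtain B B' where "B \<in> P d" "B' \<subseteq> B \<inter> A" "unbounded_in le_rel B' d"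
      by (auto simp: G_plain_def Q_def)
    then show "\<exists>B\<in>P d. unbounded_in le_rel (B \<inter> A) d"
      using unbounded_in_mono by blast
  next
    assume "\<exists>B\<in>P d. unbounded_in le_rel (B \<inter> A) d"
    then obtain B where "B \<in> P d" "unbounded_in le_rel (B \<inter> A) d" by blast
    then have "B \<inter> A \<in> Q d" by (auto simp: Q_def)
    then show "d \<in> G_plain Q A" by (auto simp: G_plain_def)
  qed
  have "\<exists>C. club le_rel C \<and> {d \<in> C \<inter> (UNIV - S_cf le_rel k). is_limit le_rel d} \<subseteq> G_plain Q A"
    "\<exists>C. club le_rel C \<and> {d \<in> C \<inter> S_cf le_rel k. is_limit le_rel d} - G_plain Q A \<in> I_lk le_rel k"
    if A: "|A| =o |UNIV :: 'a set|" for A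
  proof -
    let ?C = "limit_points A \<inter> {m..}"
    have "{d \<in> ?C \<inter> (UNIV - S_cf le_rel k). is_limit le_rel d} \<subseteq> G_plain Q A"
      using guess G by (auto simp: S_cf_def)
    moreover have "{d \<in> ?C \<inter> S_cf le_rel k. is_limit le_rel d} - G_plain Q A =
      {d \<in> limit_points A. m \<le> d \<and> is_cof le_rel d k \<and>
        \<not> (\<exists>B\<in>P d. unbounded_in le_rel (B \<inter> A) d)}"
      using G by (auto simp: S_cf_def limit_points_def)
    ultimately show "\<exists>C. club le_rel C \<and> {d \<in> C \<inter> (UNIV - S_cf le_rel k). is_limit le_rel d} \<subseteq> G_plain Q A"
      "\<exists>C. club le_rel C \<and> {d \<in> C \<inter> S_cf le_rel k. is_limit le_rel d} - G_plain Q A \<in> I_lk le_rel k"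
      using club_limit_points[OF A] ideal[of A] by auto
  qed
  then show ?thesis
    unfolding clubsuit_star_def clubsuit_star_ideal_def using fam by blast
qed

end

end

section \<open>Transfer to the given cardinal order\<close>

theorem theorem2p8:
  fixes L :: "'a rel" and m k :: 'a
  assumes "card_order L"
    and "is_cardinal L m"
    and "(card_of (UNIV :: 'a set), cardSuc (card_of (underS L m))) \<in> ordIso"
    and "is_cof L m k"
    and "olt L k m"
    and "(natLeq, card_of (underS L k)) \<in> ordLess"
  shows "(clubsuit_minus L m (UNIV - S_cf L k) \<and>
          clubsuit_minus_ideal L m (S_cf L k) (I_lk L k)) \<and>
         (strong_limit L m \<longrightarrow>
          clubsuit_star L (UNIV - S_cf L k) \<and>
          clubsuit_star_ideal L (S_cf L k) (I_lk L k))"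
proof -
  have wo: "well_order_on UNIV L" and card_order: "Card_order L" and F: "Field L = UNIV"
    using assms(1) card_order_on_Card_order card_order_on_well_order_on by (blast, blast, metis)
  then have L: "refl L" "trans L" "antisym L" "total L" "wf (L - Id)"
    by (auto simp: well_order_on_def linear_order_on_def partial_order_on_def preorder_on_def)
  have total: "(x, y) \<in> L \<or> (y, x) \<in> L" for x y
    using L(1,4) by (cases "x = y") (auto simp: refl_on_def total_on_def)
  interpret wellorder "\<lambda>x y. (x, y) \<in> L" "olt L"
  proof
    fix P x assume step: "\<And>x. (\<And>y. olt L y x \<Longrightarrow> P y) \<Longrightarrow> P x"
    show "P x"
      using L(5) by (induction x rule: wf_induct_rule) (use step in \<open>auto simp: olt_def\<close>)
  qed (use L(1-3) total in \<open>auto simp: olt_def refl_on_def trans_def antisym_def\<close>)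
  \<comment> \<open>The interpreted \<open>le_rel\<close> is this comprehension; rewriting with the
    equation restores \<open>L\<close> in the results.\<close>
  have L_eq: "{(x, y). (x, y) \<in> L} = L" by auto
  note below = underS_le_rel[unfolded L_eq]
  have less_UNIV: "r <o |UNIV :: 'a set| \<longleftrightarrow> r \<le>o |underS L m|" if "Card_order r" for r :: "'a rel"
  proof -
    have "r <o |UNIV :: 'a set| \<longleftrightarrow> r <o cardSuc |underS L m|"
      using ordLess_ordIso_trans[OF _ assms(3)] ordLess_ordIso_trans[OF _ ordIso_symmetric[OF assms(3)]]
      by blast
    then show ?thesis using cardSuc_ordLeq_ordLess[OF card_of_Card_order that] by simp
  qed
  have "L =o |UNIV :: 'a set|" using card_order F card_of_Field_ordIso ordIso_symmetric by fastforce
  \<comment> \<open>Initial segments of a cardinal order are smaller than the whole type, hence of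
    size at most \<mu>.\<close>
  then have small: "|underS L x| \<le>o |underS L m|" for x
    using card_of_underS[OF card_order, of x] less_UNIV[OF card_of_Card_order] F
      ordLess_ordIso_trans by blast
  have big: "|underS L m| <o |UNIV :: 'a set|"
    using less_UNIV[OF card_of_Card_order] ordLeq_reflexive[OF card_of_Well_order] by blast
  have "|underS L b| <o |underS L m|" if "olt L b m" for b
    using assms(2) that by (simp add: is_cardinal_def)
  note hyps = this small big assms(4,5,6)
  show ?thesis
    using clubsuit_minus_and_ideal[of m k, unfolded L_eq, folded below]
      clubsuit_star_and_ideal[of m k, unfolded L_eq, folded below] hyps
    by blast
qed

end
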